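(* Let $G$ be a connected graph with maximum degree $\Delta$ and minimum degree $\delta$. Then $$\frac{SO(G)}{2\Delta}\leq DSO(G) \leq \frac{SO(G)}{2\delta}.$$ Equality holds if and only if $G$ is a regular graph.
   Context: For a simple graph $G=(V,E)$, $d_u$ denotes the degree of vertex $u$. The Diminished Sombor index is $DSO(G)=\sum_{uv\in E}\frac{\sqrt{d_u^2+d_v^2}}{d_u+d_v}$, and the Sombor index is $SO(G)=\sum_{uv\in E}\sqrt{d_u^2+d_v^2}$. *)

theory Defs
  imports Complex_Main
begin

text \<open>A finite simple graph is given by its vertex set \<open>V\<close> and its set \<open>E\<close> of edges, each edge
  being a two-element subset of \<open>V\<close>; an edge \<open>uv\<close> is the set \<open>{u, v}\<close>.\<close>

definition simple_graph :: "'a set \<Rightarrow> 'a set set \<Rightarrow> bool" where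
  "simple_graph V E \<longleftrightarrow> finite V \<and> V \<noteq> {} \<and> (\<forall>e\<in>E. e \<subseteq> V \<and> card e = 2)"

definition connected_graph :: "'a set \<Rightarrow> 'a set set \<Rightarrow> bool" where
  "connected_graph V E \<longleftrightarrow> simple_graph V E \<and>
     (\<forall>u\<in>V. \<forall>v\<in>V. (u, v) \<in> {(x, y). {x, y} \<in> E}\<^sup>*)"

definition degree :: "'a set set \<Rightarrow> 'a \<Rightarrow> nat" where
  "degree E u = card {e \<in> E. u \<in> e}"

definition max_degree :: "'a set \<Rightarrow> 'a set set \<Rightarrow> nat" where
  "max_degree V E = Max (degree E ` V)"

definition min_degree :: "'a set \<Rightarrow> 'a set set \<Rightarrow> nat" where
  "min_degree V E = Min (degree E ` V)"

definition regular_graph :: "'a set \<Rightarrow> 'a set set \<Rightarrow> bool" where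
  "regular_graph V E \<longleftrightarrow> (\<exists>k. \<forall>v\<in>V. degree E v = k)"

text \<open>The summands over an edge \<open>uv\<close> are symmetric in \<open>u\<close> and \<open>v\<close>, so they are written as sums over
  the two elements of the edge: for \<open>e = {u, v}\<close> with \<open>u \<noteq> v\<close>, \<open>\<Sum>w\<in>e. f w\<close> is \<open>f u + f v\<close>.\<close>

definition sombor_index :: "'a set set \<Rightarrow> real" where
  "sombor_index E = (\<Sum>e\<in>E. sqrt (\<Sum>w\<in>e. (real (degree E w))\<^sup>2))"

definition diminished_sombor_index :: "'a set set \<Rightarrow> real" where
  "diminished_sombor_index E =
     (\<Sum>e\<in>E. sqrt (\<Sum>w\<in>e. (real (degree E w))\<^sup>2) / (\<Sum>w\<in>e. real (degree E w)))"

end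

theory Submission
  imports Defs
begin

text \<open>Every summand of the Diminished Sombor index is the corresponding summand of the Sombor index
  divided by \<open>d\<^sub>u + d\<^sub>v\<close>, which lies between \<open>2\<delta>\<close> and \<open>2\<Delta>\<close>. Summands are positive, so equality forces
  both ends of every edge to have the extremal degree; by connectedness every vertex is on an edge,
  unless the graph is a single vertex.\<close>

text \<open>The comparison is termwise, so equality of the sums forces equality of each pair of
  terms; as \<open>s a\<close> is positive, it cancels and leaves \<open>t a = c\<close>. Positivity
  of \<open>c\<close> comes from \<open>0 < t a\<close> and \<open>t a \<le> c\<close> once
  \<open>A\<close> has an element.\<close>

lemma sum_divide_upper:
  fixes s t :: "'b \<Rightarrow> real"
  assumes "finite A" and s: "\<And>a. a \<in> A \<Longrightarrow> 0 < s a"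
    and t: "\<And>a. a \<in> A \<Longrightarrow> 0 < t a" "\<And>a. a \<in> A \<Longrightarrow> t a \<le> c"
  shows "sum s A / c \<le> (\<Sum>a\<in>A. s a / t a)"
    and "sum s A / c = (\<Sum>a\<in>A. s a / t a) \<longleftrightarrow> (\<forall>a\<in>A. t a = c)"
proof -
  have le: "s a / c \<le> s a / t a" if "a \<in> A" for a
    using s[OF that] t[OF that] by (intro divide_left_mono) auto
  show "sum s A / c \<le> (\<Sum>a\<in>A. s a / t a)"
    unfolding sum_divide_distrib by (intro sum_mono le)
  show "sum s A / c = (\<Sum>a\<in>A. s a / t a) \<longleftrightarrow> (\<forall>a\<in>A. t a = c)"
  proof
    assume eq: "sum s A / c = (\<Sum>a\<in>A. s a / t a)"
    show "\<forall>a\<in>A. t a = c"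
    proof
      fix a assume a: "a \<in> A"
      have "s a / c = s a / t a"
        using sum_mono_inv[OF eq[unfolded sum_divide_distrib] le a \<open>finite A\<close>] .
      then show "t a = c"
        using s[OF a] t[OF a] by (simp add: field_simps)
    qed
  qed (simp add: sum_divide_distrib)
qed

text \<open>The mirror argument with \<open>c\<close> below \<open>t\<close>. Positivity of
  \<open>c\<close> is asked for only in the presence of an element of \<open>A\<close>, so that the
  single vertex without edges, where \<open>c\<close> is 0, is covered: both sums are then
  empty.\<close>

lemma sum_divide_lower:
  fixes s t :: "'b \<Rightarrow> real"
  assumes "finite A" and s: "\<And>a. a \<in> A \<Longrightarrow> 0 < s a"
    and t: "\<And>a. a \<in> A \<Longrightarrow> 0 < c" "\<And>a. a \<in> A \<Longrightarrow> c \<le> t a"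
  shows "(\<Sum>a\<in>A. s a / t a) \<le> sum s A / c"
    and "(\<Sum>a\<in>A. s a / t a) = sum s A / c \<longleftrightarrow> (\<forall>a\<in>A. t a = c)"
proof -
  have le: "s a / t a \<le> s a / c" if "a \<in> A" for a
    using s[OF that] t[OF that] by (intro divide_left_mono) auto
  show "(\<Sum>a\<in>A. s a / t a) \<le> sum s A / c"
    unfolding sum_divide_distrib by (intro sum_mono le)
  show "(\<Sum>a\<in>A. s a / t a) = sum s A / c \<longleftrightarrow> (\<forall>a\<in>A. t a = c)"
  proof
    assume eq: "(\<Sum>a\<in>A. s a / t a) = sum s A / c"
    show "\<forall>a\<in>A. t a = c"
    proof
      fix a assume a: "a \<in> A"
      have "s a / t a = s a / c"
        using sum_mono_inv[OF eq[unfolded sum_divide_distrib] le a \<open>finite A\<close>] .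
      then show "t a = c"
        using s[OF a] t[OF a] by (simp add: field_simps)
    qed
  qed (simp add: sum_divide_distrib)
qed

lemma simple_graph_finite_edges: "simple_graph V E \<Longrightarrow> finite E"
  unfolding simple_graph_def by (rule finite_subset[of E "Pow V"]) auto

lemma simple_graph_edgeE:
  assumes "simple_graph V E" "e \<in> E"
  obtains u v where "e = {u, v}" "u \<noteq> v" "u \<in> V" "v \<in> V"
proof -
  have "e \<subseteq> V" "card e = 2"
    using assms by (auto simp: simple_graph_def)
  then show thesis
    using that by (auto simp: card_2_iff)
qed

lemma degree_pos_iff: "finite E \<Longrightarrow> 0 < degree E v \<longleftrightarrow> (\<exists>e\<in>E. v \<in> e)"
  by (auto simp: degree_def card_gt_0_iff)

text \<open>A path from \<open>u\<close> to a different vertex is not empty, and its first step is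
  an edge at \<open>u\<close>.\<close>

lemma connected_graph_covered:
  assumes "connected_graph V E" "u \<in> V" "v \<in> V" "u \<noteq> v"
  shows "\<exists>e\<in>E. u \<in> e"
proof -
  have "(u, v) \<in> {(x, y). {x, y} \<in> E}\<^sup>*"
    using assms unfolding connected_graph_def by blast
  then show ?thesis
    using \<open>u \<noteq> v\<close> by (cases rule: converse_rtranclE) auto
qed

text \<open>The hypothesis on edges says nothing about a vertex on no edge. By connectedness such a
  vertex is the whole graph, which is then trivially regular.\<close>

lemma regular_graph_if_edges_regular:
  assumes "connected_graph V E" and k: "\<And>e w. e \<in> E \<Longrightarrow> w \<in> e \<Longrightarrow> degree E w = k"
  shows "regular_graph V E"
proof (cases "\<forall>v\<in>V. \<exists>e\<in>E. v \<in> e")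
  case True
  then have "\<forall>v\<in>V. degree E v = k"
    using k by blast
  then show ?thesis
    unfolding regular_graph_def ..
next
  case False
  then obtain v where v: "v \<in> V" "\<not> (\<exists>e\<in>E. v \<in> e)"
    by blast
  then have "V = {v}"
    using connected_graph_covered[OF assms(1) v(1)] by blast
  then show ?thesis
    by (simp add: regular_graph_def)
qed

theorem theorem3p11:
  fixes V :: "'a set" and E :: "'a set set"
  assumes "connected_graph V E"
  shows "sombor_index E / (2 * real (max_degree V E)) \<le> diminished_sombor_index E \<and>
    diminished_sombor_index E \<le> sombor_index E / (2 * real (min_degree V E)) \<and>
    (sombor_index E / (2 * real (max_degree V E)) = diminished_sombor_index E
       \<longleftrightarrow> regular_graph V E) \<and>
    (diminished_sombor_index E = sombor_index E / (2 * real (min_degree V E))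
       \<longleftrightarrow> regular_graph V E)"
proof -
  define s where "s e = sqrt (\<Sum>w\<in>e. (real (degree E w))\<^sup>2)" for e
  define t where "t e = (\<Sum>w\<in>e. real (degree E w))" for e
  let ?D = "max_degree V E" and ?d = "min_degree V E"
  have sg: "simple_graph V E"
    using assms by (simp add: connected_graph_def)
  then have V: "finite V" "V \<noteq> {}"
    by (simp_all add: simple_graph_def)
  have fin: "finite E"
    using sg by (rule simple_graph_finite_edges)
  have le_D: "degree E v \<le> ?D" and d_le: "?d \<le> degree E v" if "v \<in> V" for v
    using V that by (auto simp: max_degree_def min_degree_def)
  have edge: "\<exists>u v. e = {u, v} \<and> u \<noteq> v \<and> u \<in> V \<and> v \<in> V \<and> 0 < degree E u \<and> 0 < degree E v"
    if "e \<in> E" for e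
  proof -
    obtain u v where uv: "e = {u, v}" "u \<noteq> v" "u \<in> V" "v \<in> V"
      using simple_graph_edgeE[OF sg \<open>e \<in> E\<close>] .
    moreover have "0 < degree E w" if "w \<in> e" for w
      using \<open>e \<in> E\<close> that by (auto simp: degree_pos_iff[OF fin])
    ultimately show ?thesis by blast
  qed
  have s_pos: "0 < s e" if "e \<in> E" for e
    using edge[OF that] by (auto simp: s_def sum_power2_gt_zero_iff)
  have t_pos: "0 < t e" if "e \<in> E" for e
    using edge[OF that] by (auto simp: t_def)
  have t_le: "t e \<le> 2 * real ?D" if "e \<in> E" for e
  proof -
    obtain u v where "e = {u, v}" "u \<noteq> v" "u \<in> V" "v \<in> V"
      using edge[OF \<open>e \<in> E\<close>] by blast
    then show ?thesis
      using le_D[of u] le_D[of v] by (simp add: t_def)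
  qed
  have t_ge: "2 * real ?d \<le> t e" if "e \<in> E" for e
  proof -
    obtain u v where "e = {u, v}" "u \<noteq> v" "u \<in> V" "v \<in> V"
      using edge[OF \<open>e \<in> E\<close>] by blast
    then show ?thesis
      using d_le[of u] d_le[of v] by (simp add: t_def)
  qed
  \<comment> \<open>The edge matters: without one, the graph is a single vertex and the minimum
    degree is 0.\<close>
  have d_pos: "0 < 2 * real ?d" if "e \<in> E" for e
  proof -
    obtain u v where "u \<noteq> v" "u \<in> V" "v \<in> V"
      using edge[OF \<open>e \<in> E\<close>] by blast
    \<comment> \<open>Each \<open>w\<close> differs from at least one end of the edge, so
      connectedness puts it on an edge.\<close>
    then have "0 < degree E w" if "w \<in> V" for w
      unfolding degree_pos_iff[OF fin]
      using connected_graph_covered[OF assms that, of u] connected_graph_covered[OF assms that, of v]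
      by (cases "w = u") auto
    moreover have "?d \<in> degree E ` V"
      using V by (simp add: min_degree_def)
    ultimately show ?thesis by auto
  qed
  have regular: "\<forall>e\<in>E. t e = 2 * real ?D" "\<forall>e\<in>E. t e = 2 * real ?d" if reg: "regular_graph V E"
  proof -
    obtain k where k: "\<And>v. v \<in> V \<Longrightarrow> degree E v = k"
      using reg by (auto simp: regular_graph_def)
    then have "degree E ` V = {k}"
      using V by auto
    then have "?D = k" "?d = k"
      by (simp_all add: max_degree_def min_degree_def)
    moreover have "t e = 2 * real k" if "e \<in> E" for e
      using edge[OF that] k by (auto simp: t_def)
    ultimately show "\<forall>e\<in>E. t e = 2 * real ?D" "\<forall>e\<in>E. t e = 2 * real ?d"
      by simp_all
  qed
  have "regular_graph V E" if eq: "\<forall>e\<in>E. t e = 2 * real ?D"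
  proof (rule regular_graph_if_edges_regular[OF assms])
    fix e w assume e: "e \<in> E" "w \<in> e"
    obtain u v where uv: "e = {u, v}" "u \<noteq> v" "u \<in> V" "v \<in> V"
      using edge[OF e(1)] by blast
    have "real (degree E u) + real (degree E v) = 2 * real ?D"
      using eq e(1) uv by (auto simp: t_def)
    \<comment> \<open>Two numbers that are at most \<open>?D\<close> and add up to
      \<open>2 * ?D\<close> are both \<open>?D\<close>.\<close>
    then show "degree E w = ?D"
      using le_D[OF uv(3)] le_D[OF uv(4)] e(2) uv(1) by auto
  qed
  then have D_iff: "(\<forall>e\<in>E. t e = 2 * real ?D) \<longleftrightarrow> regular_graph V E"
    using regular by blast
  have "regular_graph V E" if eq: "\<forall>e\<in>E. t e = 2 * real ?d"
  proof (rule regular_graph_if_edges_regular[OF assms])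
    fix e w assume e: "e \<in> E" "w \<in> e"
    obtain u v where uv: "e = {u, v}" "u \<noteq> v" "u \<in> V" "v \<in> V"
      using edge[OF e(1)] by blast
    have "real (degree E u) + real (degree E v) = 2 * real ?d"
      using eq e(1) uv by (auto simp: t_def)
    \<comment> \<open>The same squeeze, now with \<open>?d\<close> as a lower bound for both
      degrees.\<close>
    then show "degree E w = ?d"
      using d_le[OF uv(3)] d_le[OF uv(4)] e(2) uv(1) by auto
  qed
  then have d_iff: "(\<forall>e\<in>E. t e = 2 * real ?d) \<longleftrightarrow> regular_graph V E"
    using regular by blast
  have SO: "sombor_index E = sum s E" and DSO: "diminished_sombor_index E = (\<Sum>e\<in>E. s e / t e)"
    by (simp_all add: sombor_index_def diminished_sombor_index_def s_def t_def)
  show ?thesis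
    unfolding SO DSO
    \<comment> \<open>Each lemma yields one bound together with its equality case, and
      \<open>D_iff\<close> and \<open>d_iff\<close> turn the edgewise conditions into regularity. In
      the edgeless case the divisor is 0, and \<open>0 / 0 = 0\<close> agrees with the empty
      sum.\<close>
    using sum_divide_upper[of E s t "2 * real ?D", OF fin s_pos t_pos t_le]
      sum_divide_lower[of E s "2 * real ?d" t, OF fin s_pos d_pos t_ge]
    unfolding D_iff d_iff by (intro conjI)
qed

end
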